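(* There exists a Heffter array $H(n;k)$ for all $n\equiv 2\pmod 4$ and $k\equiv 3\pmod 4$ with $n>k\ge 3$.
   Context: A Heffter array $H(n;k)$ is an $n\times n$ array in which some cells are filled with nonzero integers and the others are empty, such that: each row and each column contains exactly $k$ filled cells; the entries of every row and of every column sum to $0$ modulo $2nk+1$; and for each integer $1\le x\le nk$, exactly one of $x$ or $-x$ appears in the array, and it appears exactly once. *)

theory Defs
  imports Main
begin

text \<open>An n x n partially filled array is a function H :: nat => nat => int option,
  where H i j = None means cell (i,j) is empty; only indices i, j < n matter.\<close>

definition heffter_array :: "nat \<Rightarrow> nat \<Rightarrow> (nat \<Rightarrow> nat \<Rightarrow> int option) \<Rightarrow> bool" where
  "heffter_array n k H \<longleftrightarrow>
     (\<forall>i<n. \<forall>j<n. H i j \<noteq> Some 0) \<and>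
     (\<forall>i<n. card {j. j < n \<and> H i j \<noteq> None} = k) \<and>
     (\<forall>j<n. card {i. i < n \<and> H i j \<noteq> None} = k) \<and>
     (\<forall>i<n. (\<Sum>j\<in>{j. j < n \<and> H i j \<noteq> None}. the (H i j)) mod (2 * int n * int k + 1) = 0) \<and>
     (\<forall>j<n. (\<Sum>i\<in>{i. i < n \<and> H i j \<noteq> None}. the (H i j)) mod (2 * int n * int k + 1) = 0) \<and>
     (\<forall>x::int. 1 \<le> x \<and> x \<le> int n * int k \<longrightarrow>
        (\<exists>!c. c \<in> {0..<n} \<times> {0..<n} \<and>
              (H (fst c) (snd c) = Some x \<or> H (fst c) (snd c) = Some (- x))))"

end

theory Submission
  imports Defs
begin

text \<open>
  Put \<open>N = nk\<close> and \<open>M = 2N + 1\<close>. As \<open>M\<close> is odd, an entry is determined by its double modulo \<open>M\<close>: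
  a small entry \<open>x \<le> n\<close> has the even double \<open>2x\<close>, and \<open>- (M - w) / 2\<close> with \<open>w\<close> odd has the double \<open>w\<close>.
  So the \<open>n\<close> smallest and the \<open>2n\<close> largest absolute values can be placed by an array with three filled
  cells in each line whose entries are, up to sign, the even numbers up to \<open>2n\<close> and the odd numbers
  up to \<open>4n - 1\<close>, and whose lines sum to zero over the integers. This core does not depend on \<open>k\<close>.
  For \<open>n = 2s + 2\<close> with \<open>s\<close> even, it consists of two tridiagonal zigzags, on the first \<open>s + 2\<close> and the
  last \<open>s\<close> indices, joined by six cells in the lines of their end points.

  Folding each zigzag in the middle reorders the indices so that the core lies within distance two of
  the diagonal. The remaining absolute values \<open>n + 1, \<dots>, N - 2n\<close> go on \<open>k - 3\<close> further cyclic
  diagonals, four at a time, with two positive and two negative entries in every line that cancel.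
\<close>

section \<open>Reduction to integer matrices with \<open>0\<close> for empty cells\<close>

lemma heffter_arrayI:
  fixes V :: "nat \<Rightarrow> nat \<Rightarrow> int"
  assumes rows: "\<And>i. i < n \<Longrightarrow> card {j. j < n \<and> V i j \<noteq> 0} = k"
    and cols: "\<And>j. j < n \<Longrightarrow> card {i. i < n \<and> V i j \<noteq> 0} = k"
    and row_sums: "\<And>i. i < n \<Longrightarrow> (2 * int n * int k + 1) dvd (\<Sum>j<n. V i j)"
    and col_sums: "\<And>j. j < n \<Longrightarrow> (2 * int n * int k + 1) dvd (\<Sum>i<n. V i j)"
    and onto: "\<And>x. 1 \<le> x \<Longrightarrow> x \<le> int n * int k \<Longrightarrow> \<exists>i<n. \<exists>j<n. \<bar>V i j\<bar> = x"
  shows "heffter_array n k (\<lambda>i j. if V i j = 0 then None else Some (V i j))"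
proof -
  \<comment> \<open>There are exactly as many filled cells as absolute values to cover, so surjectivity suffices.\<close>
  define F where "F = (SIGMA i:{..<n}. {j. j < n \<and> V i j \<noteq> 0})"
  define a where "a = (\<lambda>c. \<bar>V (fst c) (snd c)\<bar>)"
  have finF: "finite F" unfolding F_def by auto
  have cardF: "card F = n * k"
    unfolding F_def by (simp add: rows)
  have sub: "{1..int n * int k} \<subseteq> a ` F"
  proof
    fix x assume "x \<in> {1..int n * int k}"
    then obtain i j where "i < n" "j < n" "\<bar>V i j\<bar> = x" "x \<noteq> 0"
      using onto[of x] by auto
    then have "(i, j) \<in> F" "x = a (i, j)" by (auto simp: F_def a_def)
    then show "x \<in> a ` F" by blast
  qed
  have "card {1..int n * int k} = n * k" by (simp flip: of_nat_mult)
  then have "card (a ` F) = card F"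
    using card_mono[OF finite_imageI[OF finF] sub] card_image_le[OF finF, of a] cardF by simp
  then have inj: "inj_on a F" using finF eq_card_imp_inj_on by blast
  have sums: "(\<Sum>j\<in>{j. j < n \<and> f j \<noteq> 0}. f j) = (\<Sum>j<n. f j)" for f :: "nat \<Rightarrow> int"
    by (rule sum.mono_neutral_left) auto
  have uniq: "\<exists>!c. c \<in> {0..<n} \<times> {0..<n} \<and>
      ((if V (fst c) (snd c) = 0 then None else Some (V (fst c) (snd c))) = Some x \<or>
       (if V (fst c) (snd c) = 0 then None else Some (V (fst c) (snd c))) = Some (- x))"
    if x: "1 \<le> x" "x \<le> int n * int k" for x
  proof -
    obtain i j where ij: "i < n" "j < n" "\<bar>V i j\<bar> = x" using onto[OF x] by blast
    show ?thesis
    proof (rule ex1I[of _ "(i, j)"])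
      fix c assume "c \<in> {0..<n} \<times> {0..<n} \<and>
      ((if V (fst c) (snd c) = 0 then None else Some (V (fst c) (snd c))) = Some x \<or>
       (if V (fst c) (snd c) = 0 then None else Some (V (fst c) (snd c))) = Some (- x))"
      then have "c \<in> F" "a c = a (i, j)"
        using x ij by (auto simp: F_def a_def split: if_splits)
      moreover have "(i, j) \<in> F" using ij x by (auto simp: F_def)
      ultimately show "c = (i, j)" using inj by (auto dest: inj_onD)
    qed (use ij x in auto)
  qed
  have ne: "(if v = 0 then None else Some v) \<noteq> None \<longleftrightarrow> v \<noteq> 0" for v :: int by simp
  have th: "(\<Sum>j\<in>{j. j < n \<and> f j \<noteq> 0}. the (if f j = 0 then None else Some (f j))) = (\<Sum>j<n. f j)"
    for f :: "nat \<Rightarrow> int"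
    unfolding sums[symmetric] by (rule sum.cong) auto
  show ?thesis
    unfolding heffter_array_def ne th
    using rows cols row_sums col_sums uniq by auto
qed

section \<open>The integer core and its line sums\<close>

lemma three_point_support:
  fixes f :: "nat \<Rightarrow> int"
  assumes "\<And>j. j < n \<Longrightarrow> f j \<noteq> 0 \<longleftrightarrow> j = a \<or> j = b \<or> j = c"
    and "a < n" "b < n" "c < n" "a \<noteq> b" "a \<noteq> c" "b \<noteq> c" "f a + f b + f c = 0"
  shows "card {j. j < n \<and> f j \<noteq> 0} = 3 \<and> (\<Sum>j<n. f j) = 0"
proof -
  have S: "{j. j < n \<and> f j \<noteq> 0} = {a, b, c}" using assms by auto
  have "(\<Sum>j<n. f j) = (\<Sum>j\<in>{j. j < n \<and> f j \<noteq> 0}. f j)"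
    by (rule sum.mono_neutral_right) auto
  then show ?thesis using assms by (simp add: S)
qed

text \<open>
  In a zigzag, cell \<open>(i, i + 1)\<close> holds \<open>edge s i\<close> and cell \<open>(i + 1, i)\<close> holds \<open>edge s i + c\<close> with \<open>c\<close>
  constant; row \<open>i\<close> and column \<open>i\<close> then force the same diagonal entry
  \<open>- (edge s i + edge s (i - 1) + c)\<close>. The two values of \<open>c\<close> are given by \<open>edge_shift\<close>.
\<close>

definition edge :: "nat \<Rightarrow> nat \<Rightarrow> int" where
  "edge s i = (if i \<le> s then (if even i then int s + 3 + int i else int i - 7 * int s - 6)
     else (if even i then 2 * int s + 3 + int i else 6 * int s + 6 + int i))"

definition edge_shift :: "nat \<Rightarrow> nat \<Rightarrow> int" where
  "edge_shift s i = (if i \<le> s then 4 * int s + 2 else - 8 * int s - 8)"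

text \<open>The first six clauses are the joining cells, in three transposed pairs. Excluding
  \<open>s + 1\<close> breaks the path between the zigzags. Lines \<open>0\<close> and
  \<open>s + 1\<close> contain two joining cells and no diagonal entry; lines \<open>s + 2\<close>
  and \<open>2 * s + 1\<close> contain one and keep it.\<close>

definition core :: "nat \<Rightarrow> nat \<Rightarrow> nat \<Rightarrow> int" where
  "core s i j =
    (if i = 0 \<and> j = s + 1 then - (2 * int s + 4)
     else if i = 0 \<and> j = s + 2 then int s + 1
     else if i = s + 1 \<and> j = 0 then 2 * int s + 2
     else if i = s + 1 \<and> j = 2 * s + 1 then - (8 * int s + 7)
     else if i = s + 2 \<and> j = 0 then - (7 * int s + 7)
     else if i = 2 * s + 1 \<and> j = s + 1 then 1
     else if j = i + 1 \<and> i \<noteq> s + 1 then edge s i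
     else if i = j + 1 \<and> j \<noteq> s + 1 then edge s j + edge_shift s j
     else if i = j then
       (if i = 0 \<or> i = s + 1 then 0
        else if i \<le> s then 2 * int s + 2 - 2 * int i
        else if i = s + 2 then 4 * int s + 2
        else if i = 2 * s + 1 then 4 * int s + 4
        else - 2 * int i)
     else 0)"

lemma core_inner_row:
  assumes "i \<noteq> 0" "i \<noteq> s + 1" "i \<noteq> s + 2" "i \<noteq> 2 * s + 1"
  shows "core s i j = (if j = i + 1 then edge s i
    else if i = j + 1 then edge s j + edge_shift s j
    else if i = j then (if i \<le> s then 2 * int s + 2 - 2 * int i else - 2 * int i) else 0)"
  using assms unfolding core_def by auto

text \<open>Only the four end rows meet joining cells. In an inner row the edges
  \<open>i - 1\<close> and \<open>i\<close> have opposite parity, so their sum has a single form,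
  which the diagonal entry cancels.\<close>

lemma core_row:
  assumes "even s" "2 \<le> s" "i < 2 * s + 2"
  shows "card {j. j < 2 * s + 2 \<and> core s i j \<noteq> 0} = 3 \<and> (\<Sum>j<2 * s + 2. core s i j) = 0"
proof -
  consider "i = 0" | "i = s + 1" | "i = s + 2" | "i = 2 * s + 1"
    | "i \<noteq> 0" "i \<noteq> s + 1" "i \<noteq> s + 2" "i \<noteq> 2 * s + 1" by blast
  then show ?thesis
  proof cases
    case 1
    show ?thesis
      unfolding 1 by (rule three_point_support[of _ _ 1 "s + 1" "s + 2"])
        (use assms in \<open>simp_all add: core_def edge_def edge_shift_def\<close>)
  next
    case 2
    show ?thesis
      unfolding 2 by (rule three_point_support[of _ _ 0 s "2 * s + 1"])
        (use assms in \<open>simp_all add: core_def edge_def edge_shift_def\<close>)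
  next
    case 3
    show ?thesis
      unfolding 3 by (rule three_point_support[of _ _ 0 "s + 2" "s + 3"])
        (use assms in \<open>simp_all add: core_def edge_def edge_shift_def\<close>)
  next
    case 4
    show ?thesis
      unfolding 4 by (rule three_point_support[of _ _ "2 * s" "2 * s + 1" "s + 1"])
        (use assms in \<open>simp_all add: core_def edge_def edge_shift_def\<close>)
  next
    case 5
    then obtain h where h: "i = Suc h" by (cases i) auto
    have e: "edge s i \<noteq> 0" "edge s h + edge_shift s h \<noteq> 0"
      using assms 5 h by (simp_all add: edge_def edge_shift_def)
    show ?thesis
      unfolding core_inner_row[OF 5]
    proof (rule three_point_support[of _ _ h i "i + 1"])
      fix j
      show "(if j = i + 1 then edge s i
    else if i = j + 1 then edge s j + edge_shift s j
    else if i = j then (if i \<le> s then 2 * int s + 2 - 2 * int i else - 2 * int i) else 0) \<noteq> 0 \<longleftrightarrow> j = h \<or> j = i \<or> j = i + 1"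
        using e h by auto
    qed (use assms 5 h in \<open>simp_all add: edge_def edge_shift_def\<close>)
  qed
qed

lemma core_inner_column:
  assumes "j \<noteq> 0" "j \<noteq> s + 1" "j \<noteq> s + 2" "j \<noteq> 2 * s + 1"
  shows "core s i j = (if j = i + 1 then edge s i
    else if i = j + 1 then edge s j + edge_shift s j
    else if i = j then (if j \<le> s then 2 * int s + 2 - 2 * int j else - 2 * int j) else 0)"
  using assms unfolding core_def by auto

text \<open>The support is symmetric, so the same three positions serve as for rows; inner sums
  agree because the shift is constant along a zigzag.\<close>

lemma core_column:
  assumes "even s" "2 \<le> s" "j < 2 * s + 2"
  shows "card {i. i < 2 * s + 2 \<and> core s i j \<noteq> 0} = 3 \<and> (\<Sum>i<2 * s + 2. core s i j) = 0"
proof -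
  consider "j = 0" | "j = s + 1" | "j = s + 2" | "j = 2 * s + 1"
    | "j \<noteq> 0" "j \<noteq> s + 1" "j \<noteq> s + 2" "j \<noteq> 2 * s + 1" by blast
  then show ?thesis
  proof cases
    case 1
    show ?thesis
      unfolding 1 by (rule three_point_support[of _ _ 1 "s + 1" "s + 2"])
        (use assms in \<open>simp_all add: core_def edge_def edge_shift_def\<close>)
  next
    case 2
    show ?thesis
      unfolding 2 by (rule three_point_support[of _ _ 0 s "2 * s + 1"])
        (use assms in \<open>simp_all add: core_def edge_def edge_shift_def\<close>)
  next
    case 3
    show ?thesis
      unfolding 3 by (rule three_point_support[of _ _ 0 "s + 2" "s + 3"])
        (use assms in \<open>simp_all add: core_def edge_def edge_shift_def\<close>)
  next
    case 4
    show ?thesis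
      unfolding 4 by (rule three_point_support[of _ _ "2 * s" "2 * s + 1" "s + 1"])
        (use assms in \<open>simp_all add: core_def edge_def edge_shift_def\<close>)
  next
    case 5
    then obtain h where h: "j = Suc h" by (cases j) auto
    have e: "edge s h \<noteq> 0" "edge s j + edge_shift s j \<noteq> 0"
      using assms 5 h by (simp_all add: edge_def edge_shift_def)
    show ?thesis
      unfolding core_inner_column[OF 5]
    proof (rule three_point_support[of _ _ h j "j + 1"])
      fix i
      show "(if j = i + 1 then edge s i
    else if i = j + 1 then edge s j + edge_shift s j
    else if i = j then (if j \<le> s then 2 * int s + 2 - 2 * int j else - 2 * int j) else 0) \<noteq> 0 \<longleftrightarrow> i = h \<or> i = j \<or> i = j + 1"
        using e h by auto
    qed (use assms 5 h in \<open>simp_all add: edge_def edge_shift_def\<close>)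
  qed
qed

section \<open>The absolute values occurring in the core\<close>

lemma core_above:
  assumes "2 \<le> s" "i \<noteq> s + 1"
  shows "core s i (i + 1) = edge s i"
  using assms by (simp add: core_def)

lemma core_below:
  assumes "2 \<le> s" "j \<noteq> s + 1"
  shows "core s (j + 1) j = edge s j + edge_shift s j"
  using assms by (simp add: core_def)

lemma core_bound:
  assumes "i < 2 * s + 2" "j < 2 * s + 2"
  shows "\<bar>core s i j\<bar> \<le> 8 * int s + 7"
proof -
  have "\<bar>edge s i\<bar> \<le> 8 * int s + 7" "\<bar>edge s j + edge_shift s j\<bar> \<le> 8 * int s + 7"
    using assms by (simp_all add: edge_def edge_shift_def)
  note e = this
  have if_le: "\<bar>a\<bar> \<le> m \<Longrightarrow> \<bar>b\<bar> \<le> m \<Longrightarrow> \<bar>if P then a else b\<bar> \<le> m" for a b m :: int and P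
    by simp
  show ?thesis
    unfolding core_def by (intro if_le) (use e assms in linarith)+
qed

text \<open>The diagonal of the first zigzag gives \<open>2, ..., 2 * s\<close>, the inner diagonal
  of the second \<open>2 * s + 6, ..., 4 * s\<close>. The four other values lie in two joining cells
  and the two end diagonal cells.\<close>

lemma core_even_onto:
  fixes w :: int
  assumes "even s" "2 \<le> s" "even w" "2 \<le> w" "w \<le> 4 * int s + 4"
  shows "\<exists>i<2 * s + 2. \<exists>j<2 * s + 2. \<bar>core s i j\<bar> = w"
proof -
  obtain u where u: "w = 2 * int u"
  proof -
    obtain z where "w = 2 * z" using assms by (elim evenE)
    then show ?thesis using that[of "nat z"] assms by simp
  qed
  consider "u \<le> s" | "u = s + 1" | "u = s + 2" | "s + 3 \<le> u" "u \<le> 2 * s" | "u = 2 * s + 1" | "u = 2 * s + 2"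
    using assms u by linarith
  then show ?thesis
  proof cases
    case 1
    show ?thesis by (rule exI[of _ "s + 1 - u"], rule conjI, use assms u 1 in simp, rule exI[of _ "s + 1 - u"])
        (use assms u 1 in \<open>auto simp: core_def\<close>)
  next
    case 2
    show ?thesis by (rule exI[of _ "s + 1"], rule conjI, simp, rule exI[of _ 0])
        (use assms u 2 in \<open>auto simp: core_def\<close>)
  next
    case 3
    show ?thesis by (rule exI[of _ 0], rule conjI, simp, rule exI[of _ "s + 1"])
        (use assms u 3 in \<open>auto simp: core_def\<close>)
  next
    case 4
    show ?thesis by (rule exI[of _ u], rule conjI, use 4 in simp, rule exI[of _ u])
        (use assms u 4 in \<open>auto simp: core_def\<close>)
  next
    case 5
    show ?thesis by (rule exI[of _ "s + 2"], rule conjI, use assms in simp, rule exI[of _ "s + 2"])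
        (use assms u 5 in \<open>auto simp: core_def\<close>)
  next
    case 6
    show ?thesis by (rule exI[of _ "2 * s + 1"], rule conjI, simp, rule exI[of _ "2 * s + 1"])
        (use assms u 6 in \<open>auto simp: core_def\<close>)
  qed
qed

text \<open>Two zigzags, two parities of the index and two sides of the diagonal give eight
  families, each covering a run of consecutive odd numbers. The runs miss \<open>1\<close>,
  \<open>s + 1\<close>, \<open>7 * s + 7\<close> and \<open>8 * s + 7\<close>, which are joining
  cells.\<close>

lemma core_odd_onto:
  fixes w :: int
  assumes "even s" "2 \<le> s" "odd w" "1 \<le> w" "w \<le> 8 * int s + 7"
  shows "\<exists>i<2 * s + 2. \<exists>j<2 * s + 2. \<bar>core s i j\<bar> = w"
proof -
  have above: ?thesis if "i < 2 * s + 1" "i \<noteq> s + 1" "\<bar>edge s i\<bar> = w" for i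
    using that core_above[of s i] assms(2) by (intro exI[of _ i] conjI exI[of _ "i + 1"]) auto
  have below: ?thesis if "i < 2 * s + 1" "i \<noteq> s + 1" "\<bar>edge s i + edge_shift s i\<bar> = w" for i
    using that core_below[of s i] assms(2) by (intro exI[of _ "i + 1"] conjI exI[of _ i]) auto
  obtain t where t: "s = 2 * t" using assms by (elim evenE)
  obtain u where u: "w = 2 * int u + 1"
  proof -
    obtain z where "w = 2 * z + 1" using assms by (elim oddE)
    then show ?thesis using that[of "nat z"] assms by simp
  qed
  consider "u \<le> t" | "t < u" "u \<le> 4 * t + 1" | "4 * t + 1 < u" "u \<le> 7 * t + 2" | "7 * t + 2 < u"
    by linarith
  then show ?thesis
  proof cases
    case 1
    then consider "u = 0" | "1 \<le> u" "u + 1 \<le> t" | "u = t"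
      using assms u t by linarith
    then show ?thesis
    proof cases
      case 1
      show ?thesis by (rule exI[of _ "2 * s + 1"], rule conjI, simp, rule exI[of _ "s + 1"])
          (use assms u 1 in \<open>simp add: core_def\<close>)
    next
      case 2
      \<comment> \<open>The entry in question is \<open>i - 2 * s - 2\<close>; equating its absolute
        value with \<open>2 * u + 1\<close> gives \<open>i\<close>. The later choices of
        \<open>i\<close> come from the other families in the same way.\<close>
      define i where "i = 4 * t + 1 - 2 * u"
      have i: "i + 2 * u = 4 * t + 1" using 2 by (auto simp: i_def)
      then have "odd i" by presburger
      then show ?thesis using i 2 t u by (intro below[of i]) (auto simp: edge_def edge_shift_def)
    next
      case 3
      show ?thesis by (rule exI[of _ 0], rule conjI, simp, rule exI[of _ "s + 2"])
          (use assms u t 3 in \<open>simp add: core_def\<close>)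
    qed
  next
    case 2
    then consider "t + 1 \<le> u" "u \<le> 2 * t + 1" | "2 * t + 2 \<le> u" "u \<le> 3 * t + 1" | "3 * t + 2 \<le> u" "u \<le> 4 * t + 1"
      using assms u t by linarith
    then show ?thesis
    proof cases
      case 1
      define i where "i = 2 * (u - t - 1)"
      have i: "i + 2 * t + 2 = 2 * u" "even i" using 1 by (auto simp: i_def)
      then show ?thesis using 1 t u by (intro above[of i]) (auto simp: edge_def edge_shift_def)
    next
      case 2
      define i where "i = 6 * t + 3 - 2 * u"
      have i: "i + 2 * u = 6 * t + 3" using 2 by (auto simp: i_def)
      then have "odd i" by presburger
      then show ?thesis using i 2 t u by (intro below[of i]) (auto simp: edge_def edge_shift_def)
    next
      case 3
      define i where "i = 2 * u - 4 * t - 2"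
      have i: "i + 4 * t + 2 = 2 * u" using 3 by (auto simp: i_def)
      then have "even i" by presburger
      then show ?thesis using i 3 t u by (intro above[of i]) (auto simp: edge_def edge_shift_def)
    qed
  next
    case 3
    then consider "4 * t + 2 \<le> u" "u \<le> 5 * t + 1" | "5 * t + 2 \<le> u" "u \<le> 6 * t + 2" | "6 * t + 3 \<le> u" "u \<le> 7 * t + 2"
      using assms u t by linarith
    then show ?thesis
    proof cases
      case 1
      define i where "i = 12 * t + 4 - 2 * u"
      have i: "i + 2 * u = 12 * t + 4" using 1 by (auto simp: i_def)
      then have "even i" by presburger
      then show ?thesis using i 1 t u by (intro below[of i]) (auto simp: edge_def edge_shift_def)
    next
      case 2
      define i where "i = 2 * u - 10 * t - 4"
      have i: "i + 10 * t + 4 = 2 * u" using 2 by (auto simp: i_def)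
      then have "even i" by presburger
      then show ?thesis using i 2 t u by (intro below[of i]) (auto simp: edge_def edge_shift_def)
    next
      case 3
      define i where "i = 14 * t + 5 - 2 * u"
      have i: "i + 2 * u = 14 * t + 5" using 3 by (auto simp: i_def)
      then have "odd i" by presburger
      then show ?thesis using i 3 t u by (intro above[of i]) (auto simp: edge_def edge_shift_def)
    qed
  next
    case 4
    then consider "u = 7 * t + 3" | "7 * t + 4 \<le> u" "u \<le> 8 * t + 2" | "u = 8 * t + 3"
      using assms u t by linarith
    then show ?thesis
    proof cases
      case 1
      show ?thesis by (rule exI[of _ "s + 2"], rule conjI, use assms in simp, rule exI[of _ 0])
          (use assms u t 1 in \<open>simp add: core_def\<close>)
    next
      case 2
      define i where "i = 2 * u - 12 * t - 5"
      have i: "i + 12 * t + 5 = 2 * u" using 2 by (auto simp: i_def)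
      then have "odd i" by presburger
      then show ?thesis using i 2 t u by (intro above[of i]) (auto simp: edge_def edge_shift_def)
    next
      case 3
      show ?thesis by (rule exI[of _ "s + 1"], rule conjI, simp, rule exI[of _ "2 * s + 1"])
          (use assms u t 3 in \<open>simp add: core_def\<close>)
    qed
  qed
qed

section \<open>Folding the index order\<close>

text \<open>The order of the indices in which both zigzags are folded and their four end points
  occupy the consecutive positions \<open>s, \<dots>, s + 3\<close>.\<close>

definition fold_pos :: "nat \<Rightarrow> nat \<Rightarrow> nat" where
  "fold_pos s v = (if 2 * v \<le> s then s - 2 * v else if v \<le> s + 1 then 2 * v - s - 1
     else if 2 * v < 3 * s + 4 then 2 * v - s - 2 else 5 * s + 5 - 2 * v)"

lemma bij_fold_pos:
  assumes "even s"
  shows "bij_betw (fold_pos s) {..<2 * s + 2} {..<2 * s + 2}"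
proof -
  obtain t where t: "s = 2 * t" using assms by (elim evenE)
  have sub: "fold_pos s ` {..<2 * s + 2} \<subseteq> {..<2 * s + 2}"
    by (auto simp: fold_pos_def)
  have sup: "{..<2 * s + 2} \<subseteq> fold_pos s ` {..<2 * s + 2}"
  proof
    fix y assume y: "y \<in> {..<2 * s + 2}"
    obtain z where "y = 2 * z \<or> y = 2 * z + 1" by (meson evenE oddE)
    then consider "y = 2 * z" "z \<le> t" | "y = 2 * z" "t < z" | "y = 2 * z + 1" "z \<le> t" | "y = 2 * z + 1" "t < z"
      by linarith
    then show "y \<in> fold_pos s ` {..<2 * s + 2}"
    proof cases
      case 1
      then show ?thesis using t y by (intro image_eqI[of _ _ "t - z"]) (auto simp: fold_pos_def)
    next
      case 2
      then show ?thesis using t y by (intro image_eqI[of _ _ "z + t + 1"]) (auto simp: fold_pos_def)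
    next
      case 3
      then show ?thesis using t y by (intro image_eqI[of _ _ "z + t + 1"]) (auto simp: fold_pos_def)
    next
      case 4
      then show ?thesis using t y by (intro image_eqI[of _ _ "5 * t + 2 - z"]) (auto simp: fold_pos_def)
    qed
  qed
  then have "inj_on (fold_pos s) {..<2 * s + 2}" by (rule finite_surj_inj[rotated]) simp
  then show ?thesis using sub sup by (simp add: bij_betw_def)
qed

text \<open>Neighbours in a folded zigzag get positions two apart, or one apart at the fold, and
  joining cells connect only ends at most two positions apart.\<close>

lemma core_near_diagonal:
  assumes "even s" "2 \<le> s" "i < 2 * s + 2" "j < 2 * s + 2" "core s i j \<noteq> 0"
  shows "fold_pos s i \<le> fold_pos s j + 2 \<and> fold_pos s j \<le> fold_pos s i + 2"
proof -
  obtain t where t: "s = 2 * t" using assms by (elim evenE)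
  have step: "fold_pos s v \<le> fold_pos s (v + 1) + 2 \<and> fold_pos s (v + 1) \<le> fold_pos s v + 2"
    if v: "v \<noteq> s + 1" "v < 2 * s + 1" for v
  proof -
    consider "v < t" | "v = t" | "t < v" "v \<le> 2 * t" | "2 * t + 2 \<le> v" "v \<le> 3 * t"
      | "v = 3 * t + 1" | "3 * t + 2 \<le> v"
      using v assms(2) t by linarith
    then show ?thesis
      by cases (use v t in \<open>auto simp: fold_pos_def\<close>)
  qed
  have ends: "fold_pos s 0 = s" "fold_pos s (s + 1) = s + 1"
      "fold_pos s (s + 2) = s + 2" "fold_pos s (2 * s + 1) = s + 3"
    using assms(2) unfolding fold_pos_def t by auto
  have "i = 0 \<and> j = s + 1 \<or> i = 0 \<and> j = s + 2 \<or> i = s + 1 \<and> j = 0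
    \<or> i = s + 1 \<and> j = 2 * s + 1 \<or> i = s + 2 \<and> j = 0 \<or> i = 2 * s + 1 \<and> j = s + 1
    \<or> j = i + 1 \<and> i \<noteq> s + 1 \<or> i = j + 1 \<and> j \<noteq> s + 1 \<or> i = j"
  proof (rule ccontr)
    assume "\<not> ?thesis"
    then have "core s i j = 0" by (simp only: core_def de_Morgan_disj if_False simp_thms)
    then show False using assms(5) by simp
  qed
  then show ?thesis
    using step[of i] step[of j] ends assms(3,4) by (elim disjE) auto
qed

section \<open>Halving modulo an odd number\<close>

text \<open>For odd \<open>M\<close> and \<open>w\<close> between \<open>- M\<close> and
  \<open>M\<close>, this represents \<open>w / 2\<close> modulo \<open>M\<close> with absolute value
  below \<open>M / 2\<close>.\<close>

definition lift_mod :: "int \<Rightarrow> int \<Rightarrow> int" where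
  "lift_mod M w = (if even w then w div 2 else if w > 0 then (w - M) div 2 else (w + M) div 2)"

lemma lift_mod_dvd:
  assumes "odd M"
  shows "M dvd 2 * lift_mod M w - w"
  using assms by (auto simp: lift_mod_def)

lemma lift_mod_eq_0_iff:
  assumes "\<bar>w\<bar> < M" "odd M"
  shows "lift_mod M w = 0 \<longleftrightarrow> w = 0"
proof -
  have "- M < w" "w < M" using assms(1) by auto
  then show ?thesis using assms(2) unfolding lift_mod_def by presburger
qed

lemma abs_lift_mod_even:
  assumes "\<bar>w\<bar> = 2 * x"
  shows "\<bar>lift_mod M w\<bar> = x"
proof -
  have "w = 2 * x \<or> w = 2 * (- x)" "0 \<le> x" using assms by linarith+
  then show ?thesis by (elim disjE) (simp_all add: lift_mod_def)
qed

lemma abs_lift_mod_odd: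
  assumes "odd M" "\<bar>w\<bar> = M - 2 * x" "0 \<le> x"
  shows "\<bar>lift_mod M w\<bar> = x"
proof -
  have odd: "odd w" using assms(1,2) by presburger
  have "w > 0 \<and> w - M = 2 * (- x) \<or> \<not> w > 0 \<and> w + M = 2 * x" using assms(2) by linarith
  then show ?thesis
  proof (elim disjE conjE)
    assume "w > 0" "w - M = 2 * (- x)"
    then show ?thesis using odd assms(3) by (simp add: lift_mod_def)
  next
    assume "\<not> w > 0" "w + M = 2 * x"
    then show ?thesis using odd assms(3) by (simp add: lift_mod_def)
  qed
qed

text \<open>Twice the lifted sum is congruent to the original sum, and \<open>2\<close> cancels
  modulo an odd \<open>M\<close>.\<close>

lemma lift_mod_sum_dvd:
  assumes "odd M" "finite A" "(\<Sum>a\<in>A. f a) = 0"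
  shows "M dvd (\<Sum>a\<in>A. lift_mod M (f a))"
proof -
  have "M dvd (\<Sum>a\<in>A. 2 * lift_mod M (f a) - f a)"
    by (rule dvd_sum) (simp add: lift_mod_dvd assms)
  then have "M dvd 2 * (\<Sum>a\<in>A. lift_mod M (f a))"
    by (simp add: sum_subtractf sum_distrib_left assms)
  moreover have "coprime M 2" using assms(1) by simp
  ultimately show ?thesis using coprime_dvd_mult_right_iff by blast
qed

section \<open>Cyclic diagonals for the middle absolute values\<close>

text \<open>
  The shift \<open>r + 2\<close> in the last two diagonals aligns their wrap-around with that of the first two,
  so that column sums vanish as well as row sums.
\<close>

definition quad :: "nat \<Rightarrow> int \<Rightarrow> nat \<Rightarrow> nat \<Rightarrow> int" where
  "quad n b r m =
    (if m = 0 then b + 2 * int r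
     else if m = 1 then - (b + 2 * int r + 1)
     else if m = 2 then - (b + 2 * int n + 2 * int ((r + 2) mod n))
     else b + 2 * int n + 2 * int ((r + 2) mod n) + 1)"

text \<open>Here \<open>r\<close> is a row position and \<open>d\<close> the cyclic offset of the
  column from it. Offsets start at \<open>3\<close> because the core uses those up to two on either
  side; block \<open>q\<close> takes the \<open>4 * n\<close> values from
  \<open>n + 1 + 4 * n * q\<close> on.\<close>

definition filler :: "nat \<Rightarrow> nat \<Rightarrow> nat \<Rightarrow> nat \<Rightarrow> int" where
  "filler n p r d = (if 3 \<le> d \<and> d < 4 * p + 3
     then quad n (int n + 1 + 4 * int n * int ((d - 3) div 4)) r ((d - 3) mod 4) else 0)"

lemma filler_block:
  assumes "q < p" "m < 4"
  shows "filler n p r (4 * q + m + 3) = quad n (int n + 1 + 4 * int n * int q) r m"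
  using assms by (simp add: filler_def)

lemma filler_block_values:
  assumes "q < p"
  shows "filler n p r (4 * q + 3) = int n + 1 + 4 * int n * int q + 2 * int r"
    and "filler n p r (4 * q + 4) = - (int n + 1 + 4 * int n * int q + 2 * int r + 1)"
    and "filler n p r (4 * q + 5) = - (int n + 1 + 4 * int n * int q + 2 * int n + 2 * int ((r + 2) mod n))"
    and "filler n p r (4 * q + 6) = int n + 1 + 4 * int n * int q + 2 * int n + 2 * int ((r + 2) mod n) + 1"
  using filler_block[OF assms, of 0 n r] filler_block[OF assms, of 1 n r]
    filler_block[OF assms, of 2 n r] filler_block[OF assms, of 3 n r]
  by (simp_all add: quad_def add.commute[of "4 * q"])

lemma filler_eq_0_iff: "filler n p r d = 0 \<longleftrightarrow> \<not> (3 \<le> d \<and> d < 4 * p + 3)"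
proof -
  have "quad n b r m \<noteq> 0" if "b > 0" for b m
    using that by (simp add: quad_def)
  moreover have "int n + 1 + 4 * int n * int ((d - 3) div 4) > 0"
    by (simp add: add_pos_nonneg)
  ultimately show ?thesis by (simp add: filler_def)
qed

lemma sum_diagonal_blocks:
  fixes f :: "nat \<Rightarrow> int"
  assumes "4 * p + 3 \<le> n" "\<And>d. \<not> (3 \<le> d \<and> d < 4 * p + 3) \<Longrightarrow> f d = 0"
    and blocks: "\<And>q. q < p \<Longrightarrow> f (4 * q + 3) + f (4 * q + 4) + f (4 * q + 5) + f (4 * q + 6) = 0"
  shows "(\<Sum>d<n. f d) = 0"
proof -
  have "(\<Sum>d<n. f d) = (\<Sum>d\<in>{3..<4 * p + 3}. f d)"
    by (rule sum.mono_neutral_right) (use assms in auto)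
  also have "(\<Sum>d\<in>{3..<4 * p' + 3}. f d) = 0" if "p' \<le> p" for p'
    using that
  proof (induction p')
    case (Suc p')
    have eq: "4 * Suc p' + 3 = Suc (Suc (Suc (Suc (4 * p' + 3))))" by simp
    have "f (4 * p' + 3) + f (Suc (4 * p' + 3)) + f (Suc (Suc (4 * p' + 3))) + f (Suc (Suc (Suc (4 * p' + 3)))) = 0"
      using blocks[of p'] Suc.prems by (simp add: numeral_eq_Suc)
    moreover have aux: "sum f {3..<Suc (Suc (Suc (Suc m)))} = sum f {3..<m} + (f m + f (Suc m) + f (Suc (Suc m)) + f (Suc (Suc (Suc m))))"
      if "3 \<le> m" for m
      using that by simp
    ultimately show ?case unfolding eq using Suc aux[of "4 * p' + 3"] by linarith
  qed simp
  finally show ?thesis by simp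
qed

lemma filler_row_sum:
  assumes "4 * p + 3 \<le> n"
  shows "(\<Sum>d<n. filler n p r d) = 0"
proof (rule sum_diagonal_blocks[OF assms])
  fix q assume "q < p"
  then show "filler n p r (4 * q + 3) + filler n p r (4 * q + 4) + filler n p r (4 * q + 5) + filler n p r (4 * q + 6) = 0"
    by (simp only: filler_block_values)
qed (simp add: filler_eq_0_iff)

text \<open>Column \<open>c\<close> meets diagonal \<open>d\<close> in row
  \<open>(c + n - d) mod n\<close>. The shift by two gives the first and third cell of a block the
  same row number, likewise the second and fourth; these pairs sum to \<open>- 2 * n\<close> and
  \<open>2 * n\<close>.\<close>

lemma filler_column_sum:
  assumes "4 * p + 3 \<le> n"
  shows "(\<Sum>d<n. filler n p ((c + n - d) mod n) d) = 0"
proof (rule sum_diagonal_blocks[OF assms])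
  fix q assume q: "q < p"
  define \<rho> where "\<rho> d = (c + n - d) mod n" for d
  have shift: "(\<rho> (d + 2) + 2) mod n = \<rho> d" if "d + 2 \<le> n" for d
  proof -
    have "(\<rho> (d + 2) + 2) mod n = (c + n - (d + 2) + 2) mod n"
      unfolding \<rho>_def by (simp add: mod_simps)
    also have "c + n - (d + 2) + 2 = c + n - d" using that by simp
    finally show ?thesis by (simp add: \<rho>_def)
  qed
  have "(\<rho> (4 * q + 5) + 2) mod n = \<rho> (4 * q + 3)" "(\<rho> (4 * q + 6) + 2) mod n = \<rho> (4 * q + 4)"
    using shift[of "4 * q + 3"] shift[of "4 * q + 4"] q assms by (simp_all add: numeral_eq_Suc)
  then show "filler n p ((c + n - (4 * q + 3)) mod n) (4 * q + 3) + filler n p ((c + n - (4 * q + 4)) mod n) (4 * q + 4)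
      + filler n p ((c + n - (4 * q + 5)) mod n) (4 * q + 5) + filler n p ((c + n - (4 * q + 6)) mod n) (4 * q + 6) = 0"
    unfolding \<rho>_def[symmetric]
    by (simp only: filler_block_values[OF q])
qed (simp add: filler_eq_0_iff)

lemma filler_onto:
  fixes x :: int
  assumes "0 < n" "int n < x" "x \<le> int n + 4 * int p * int n"
  shows "\<exists>r<n. \<exists>d. 3 \<le> d \<and> d < 4 * p + 3 \<and> \<bar>filler n p r d\<bar> = x"
proof -
  define y where "y = nat (x - int n - 1)"
  have x: "x = int n + 1 + int y" using assms by (simp add: y_def)
  then have "int y < int (4 * p * n)" using assms by simp
  then have y: "y < 4 * n * p" by (simp only: of_nat_less_iff mult.commute mult.left_commute)
  define q where "q = y div (4 * n)"
  define z where "z = y mod (4 * n)"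
  have yq: "y = 4 * n * q + z" by (simp add: q_def z_def)
  have q: "q < p" using y assms(1) by (simp add: q_def less_mult_imp_div_less mult.commute)
  have z: "z < 4 * n" using assms(1) by (simp add: z_def)
  define b where "b = int n + 1 + 4 * int n * int q"
  have witness: ?thesis if "r < n" "m < 4" "\<bar>quad n b r m\<bar> = x" for r m
    using that q filler_block[OF q that(2), of n r] unfolding b_def
    by (intro exI[of _ r] conjI exI[of _ "4 * q + m + 3"]) auto
  have x': "x = b + int z" using x yq by (simp add: b_def)
  have b: "b \<ge> 0" by (simp add: b_def)
  show ?thesis
  proof (cases "z < 2 * n")
    case True
    show ?thesis
      \<comment> \<open>Within a pair of diagonals, consecutive values alternate between the two:
        the parity selects the diagonal, the half the row.\<close>
      by (rule witness[of "z div 2" "z mod 2"])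
        (use True x' b in \<open>auto simp: quad_def mod_2_eq_odd elim!: evenE oddE\<close>)
  next
    case False
    define u where "u = z - 2 * n"
    have u: "z = 2 * n + u" "u < 2 * n" using False z by (auto simp: u_def)
    \<comment> \<open>This row undoes the shift by two in \<open>quad\<close>; adding
      \<open>2 * n\<close> keeps the natural subtraction exact even for
      \<open>n = 1\<close>.\<close>
    have r: "((u div 2 + 2 * n - 2) mod n + 2) mod n = u div 2"
    proof -
      have "((u div 2 + 2 * n - 2) mod n + 2) mod n = (u div 2 + 2 * n - 2 + 2) mod n"
        by (rule mod_add_left_eq)
      also have "u div 2 + 2 * n - 2 + 2 = u div 2 + 2 * n" using assms(1) by simp
      finally show ?thesis using u by simp
    qed
    show ?thesis
      by (rule witness[of "(u div 2 + 2 * n - 2) mod n" "2 + u mod 2"])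
        (use u x' b r assms(1) in \<open>auto simp: quad_def mod_2_eq_odd elim!: evenE oddE\<close>)
  qed
qed

section \<open>Passing between rows, columns and cyclic diagonals\<close>

lemma bij_mod_diff:
  fixes n r :: nat
  assumes "r < n"
  shows "bij_betw (\<lambda>c. (c + n - r) mod n) {..<n} {..<n}"
proof (rule bij_betw_byWitness[where f' = "\<lambda>d. (r + d) mod n"])
  show "\<forall>c\<in>{..<n}. (r + (c + n - r) mod n) mod n = c"
    using assms by (simp add: mod_add_right_eq)
  show "\<forall>d\<in>{..<n}. ((r + d) mod n + n - r) mod n = d"
  proof
    fix d assume d: "d \<in> {..<n}"
    have "((r + d) mod n + (n - r)) mod n = (r + d + (n - r)) mod n"
      by (rule mod_add_left_eq)
    then show "((r + d) mod n + n - r) mod n = d" using assms d by simp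
  qed
qed (use assms in auto)

lemma mod_diff_involution:
  fixes c n r :: nat
  assumes "c < n" "r < n"
  shows "(c + n - (c + n - r) mod n) mod n = r"
  using assms by (cases "r \<le> c") (auto simp: mod_if)

lemma bij_mod_diff':
  fixes c n :: nat
  assumes "c < n"
  shows "bij_betw (\<lambda>r. (c + n - r) mod n) {..<n} {..<n}"
  by (rule bij_betw_byWitness[where f' = "\<lambda>r. (c + n - r) mod n"])
    (auto simp: mod_diff_involution[OF assms])

lemma card_Collect_bij:
  assumes "bij_betw g {..<n} {..<n::nat}"
  shows "card {j. j < n \<and> P (g j)} = card {d. d < n \<and> P d}"
proof (rule bij_betw_same_card[of g])
  show "bij_betw g {j. j < n \<and> P (g j)} {d. d < n \<and> P d}"
    using bij_betw_Collect[OF assms, of P "\<lambda>j. P (g j)"] by simp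
qed

section \<open>Assembly of the array\<close>

theorem theorem5p2:
  fixes n k :: nat
  assumes "n mod 4 = 2" and "k mod 4 = 3" and "n > k" and "k \<ge> 3"
  shows "\<exists>H. heffter_array n k H"
proof -
  define s where "s = n div 2 - 1"
  define p where "p = k div 4"
  define M where "M = 2 * int n * int k + 1"
  define pos where "pos = fold_pos s"
  define diag where "diag i j = (pos j + n - pos i) mod n" for i j
  \<comment> \<open>In each cell at most one summand is nonzero, as \<open>disjoint\<close> shows.
    Only the filler uses folded positions for its layout; the core keeps its own indices.\<close>
  define V where "V i j = lift_mod M (core s i j) + filler n p (pos i) (diag i j)" for i j
  have n: "n = 2 * s + 2" and s: "even s" "2 \<le> s"
    using assms(1,3,4) unfolding s_def by presburger+
  have k: "k = 4 * p + 3" using assms(2) unfolding p_def by presburger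
  \<comment> \<open>The residues force \<open>n - k\<close> to be \<open>3\<close> modulo
    \<open>4\<close>, hence \<open>n \<ge> k + 3\<close>; this leaves the offsets
    \<open>n - 2\<close> and \<open>n - 1\<close> to the core.\<close>
  have p: "4 * p + 6 \<le> n" using assms(1,3) k by presburger
  have M: "odd M" by (simp add: M_def)
  have nk: "int n * int k = 4 * int p * int n + 3 * int n" by (simp add: k algebra_simps)
  have M_eq: "M = 8 * int p * int n + 6 * int n + 1" unfolding M_def using nk by simp
  have ns: "int n = 2 * int s + 2" by (simp add: n)
  have "8 * int p * int n \<ge> 0" by simp
  then have M_gt: "M > 8 * int s + 7" using M_eq ns by linarith
  have bij: "bij_betw pos {..<n} {..<n}"
    unfolding pos_def n using bij_fold_pos[OF s(1)] .
  have pos_less: "pos i < n" if "i < n" for i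
    using bij_betwE[OF bij] that by auto
  have bij_row: "bij_betw (diag i) {..<n} {..<n}" if "i < n" for i
    using bij_betw_trans[OF bij bij_mod_diff[OF pos_less[OF that]]]
    by (simp add: diag_def[abs_def] comp_def)
  have bij_col: "bij_betw (\<lambda>i. diag i j) {..<n} {..<n}" if "j < n" for j
    using bij_betw_trans[OF bij bij_mod_diff'[OF pos_less[OF that]]]
    by (simp add: diag_def comp_def)
  have core_less: "\<bar>core s i j\<bar> < M" if "i < n" "j < n" for i j
    using core_bound[of i s j] that M_gt by (simp add: n)
  have disjoint: "\<not> (3 \<le> diag i j \<and> diag i j < 4 * p + 3)" if "i < n" "j < n" "core s i j \<noteq> 0" for i j
  proof -
    have "pos i \<le> pos j + 2" "pos j \<le> pos i + 2"
      using core_near_diagonal[of s i j] that s unfolding pos_def n by auto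
    then show ?thesis
      using pos_less[OF that(1)] pos_less[OF that(2)] p unfolding diag_def
      by (cases "pos i \<le> pos j") (auto simp: mod_if)
  qed
  have V_eq_0: "V i j \<noteq> 0 \<longleftrightarrow> core s i j \<noteq> 0 \<or> 3 \<le> diag i j \<and> diag i j < 4 * p + 3"
    if "i < n" "j < n" for i j
  proof (cases "core s i j = 0")
    case True
    then show ?thesis
      using filler_eq_0_iff[of n p "pos i" "diag i j"] by (simp add: V_def lift_mod_def)
  next
    case False
    then show ?thesis
      using disjoint[OF that False] filler_eq_0_iff[of n p "pos i" "diag i j"]
        lift_mod_eq_0_iff[OF core_less[OF that] M] by (simp add: V_def)
  qed
  have card_diags: "card {d. d < n \<and> 3 \<le> d \<and> d < 4 * p + 3} = 4 * p"
  proof -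
    have "{d. d < n \<and> 3 \<le> d \<and> d < 4 * p + 3} = {3..<4 * p + 3}" using p by auto
    then show ?thesis by simp
  qed
  have "heffter_array n k (\<lambda>i j. if V i j = 0 then None else Some (V i j))"
  proof (rule heffter_arrayI)
    fix i assume i: "i < n"
    have "{j. j < n \<and> V i j \<noteq> 0}
        = {j. j < n \<and> core s i j \<noteq> 0} \<union> {j. j < n \<and> 3 \<le> diag i j \<and> diag i j < 4 * p + 3}"
      using V_eq_0[OF i] by blast
    also have "card \<dots> = 3 + 4 * p"
      using core_row[OF s, of i] i card_Collect_bij[OF bij_row[OF i], of "\<lambda>d. 3 \<le> d \<and> d < 4 * p + 3"]
        disjoint[OF i] card_diags unfolding n by (subst card_Un_disjoint) auto
    finally show "card {j. j < n \<and> V i j \<noteq> 0} = k" by (simp add: k)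
    have "M dvd (\<Sum>j<n. lift_mod M (core s i j))"
      using core_row[OF s, of i] i unfolding n by (intro lift_mod_sum_dvd[OF M]) auto
    moreover have "(\<Sum>j<n. filler n p (pos i) (diag i j)) = 0"
      using sum.reindex_bij_betw[OF bij_row[OF i], of "filler n p (pos i)"] filler_row_sum[of p n "pos i"] p by simp
    ultimately show "(2 * int n * int k + 1) dvd (\<Sum>j<n. V i j)"
      unfolding V_def M_def[symmetric] by (simp add: sum.distrib)
  next
    fix j assume j: "j < n"
    have "{i. i < n \<and> V i j \<noteq> 0}
        = {i. i < n \<and> core s i j \<noteq> 0} \<union> {i. i < n \<and> 3 \<le> diag i j \<and> diag i j < 4 * p + 3}"
      using V_eq_0[OF _ j] by blast
    also have "card \<dots> = 3 + 4 * p"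
      using core_column[OF s, of j] j card_Collect_bij[OF bij_col[OF j], of "\<lambda>d. 3 \<le> d \<and> d < 4 * p + 3"]
        disjoint[OF _ j] card_diags unfolding n by (subst card_Un_disjoint) auto
    finally show "card {i. i < n \<and> V i j \<noteq> 0} = k" by (simp add: k)
    have "M dvd (\<Sum>i<n. lift_mod M (core s i j))"
      using core_column[OF s, of j] j unfolding n by (intro lift_mod_sum_dvd[OF M]) auto
    moreover have "(\<Sum>i<n. filler n p (pos i) (diag i j)) = 0"
    proof -
      \<comment> \<open>Column and offset determine the row, so the sum over rows becomes a sum over
        offsets.\<close>
      have "(\<Sum>i<n. filler n p (pos i) (diag i j))
          = (\<Sum>i<n. filler n p ((pos j + n - diag i j) mod n) (diag i j))"
        by (rule sum.cong) (simp_all add: diag_def mod_diff_involution pos_less j)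
      also have "\<dots> = (\<Sum>d<n. filler n p ((pos j + n - d) mod n) d)"
        by (rule sum.reindex_bij_betw[OF bij_col[OF j]])
      finally show ?thesis using filler_column_sum[of p n "pos j"] p by simp
    qed
    ultimately show "(2 * int n * int k + 1) dvd (\<Sum>i<n. V i j)"
      unfolding V_def M_def[symmetric] by (simp add: sum.distrib)
  next
    fix x assume x: "1 \<le> x" "x \<le> int n * int k"
    have from_core: "\<exists>i<n. \<exists>j<n. \<bar>V i j\<bar> = x"
      if w: "\<exists>i<n. \<exists>j<n. \<bar>core s i j\<bar> = w" "w \<noteq> 0"
        and lift: "\<And>v. \<bar>v\<bar> = w \<Longrightarrow> \<bar>lift_mod M v\<bar> = x" for w
    proof -
      obtain i j where ij: "i < n" "j < n" "\<bar>core s i j\<bar> = w" using w by blast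
      then have "core s i j \<noteq> 0" using w(2) by auto
      then have "filler n p (pos i) (diag i j) = 0"
        using disjoint[of i j] ij filler_eq_0_iff by blast
      then have "\<bar>V i j\<bar> = x" using ij lift[of "core s i j"] by (simp add: V_def)
      then show ?thesis using ij by blast
    qed
    consider "x \<le> int n" | "int n < x" "x \<le> int n + 4 * int p * int n" | "int n + 4 * int p * int n < x"
      by linarith
    then show "\<exists>i<n. \<exists>j<n. \<bar>V i j\<bar> = x"
    proof cases
      case 1
      have "\<exists>i<n. \<exists>j<n. \<bar>core s i j\<bar> = 2 * x"
        using core_even_onto[OF s, of "2 * x"] x 1 unfolding n by simp
      then show ?thesis
        by (rule from_core) (use x in \<open>simp_all add: abs_lift_mod_even\<close>)
    next
      case 2
      have "0 < n" by (simp add: n)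
      from filler_onto[OF this 2] obtain r d where rd: "r < n" "3 \<le> d" "d < 4 * p + 3" "\<bar>filler n p r d\<bar> = x"
        by blast
      obtain i where i: "i < n" "pos i = r"
        using bij rd(1) by (metis bij_betw_imp_surj_on image_iff lessThan_iff)
      have "d \<in> {..<n}" using rd p by simp
      then obtain j where j: "j < n" "diag i j = d"
        using bij_row[OF i(1)] by (metis bij_betw_imp_surj_on image_iff lessThan_iff)
      then have "core s i j = 0" using disjoint[OF i(1) j(1)] rd by blast
      then have "V i j = filler n p r d" using i j by (simp add: V_def lift_mod_def)
      then show ?thesis using i j rd by metis
    next
      case 3
      \<comment> \<open>In this range \<open>M - 2 * x\<close> is odd and lies between
        \<open>1\<close> and \<open>4 * n - 1 = 8 * s + 7\<close>, as the odd core values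
        do.\<close>
      define w where "w = M - 2 * x"
      have "odd w" using M by (simp add: w_def)
      moreover have "1 \<le> w" using x nk M_eq unfolding w_def by linarith
      moreover have "w \<le> 8 * int s + 7" using 3 nk M_eq ns unfolding w_def by linarith
      ultimately have w: "odd w" "1 \<le> w" "w \<le> 8 * int s + 7" by blast+
      have "\<exists>i<n. \<exists>j<n. \<bar>core s i j\<bar> = w"
        using core_odd_onto[OF s w] unfolding n by simp
      then show ?thesis
        by (rule from_core) (use x w M in \<open>auto intro: abs_lift_mod_odd simp: w_def\<close>)
    qed
  qed
  then show ?thesis by blast
qed

end
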